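(* Let $A\in\mathbb{R}^{m\times n}$, $\boldsymbol c\in\mathbb{R}^n$ with $\lVert\boldsymbol c\rVert=1$, and consider $(\mathrm P)$: $\max\{\boldsymbol c^T\boldsymbol x:A\boldsymbol x\le\mathbf 1\}$. Assume exact arithmetic and deterministic tie-breaking in Wolfe's nearest-point subroutine. Then in the algorithm P-LPN applied to $(\mathrm P)$ every Wolfe call terminates. P-LPN returns either a primal--dual optimum $(\boldsymbol x^*,\boldsymbol u^* )$ for $(\mathrm P)$ (the case $\rho^*>0$, in which the optimal value is $1/\rho^*$, and the pair is recovered at $\boldsymbol q^*=\rho^*\boldsymbol c$ by $\boldsymbol x^*=\boldsymbol d/(\boldsymbol d^T\boldsymbol q^* )$ from a supporting normal $\boldsymbol d$ of $\mathcal Q$ at $\boldsymbol q^*$ with $\boldsymbol d^T\boldsymbol q^*>0$ and by $u_i^*=\lambda_i/\rho^*$ from convex weights with $\boldsymbol q^*=\sum_{i=1}^m\lambda_i\boldsymbol a_i$), or a feasible recession direction $\boldsymbol r$, with $A\boldsymbol r\le\boldsymbol 0$ and $\boldsymbol c^T\boldsymbol r=1$, certifying that $(\mathrm P)$ is unbounded (the case $\rho^*=0$). It performs at most $$K(m+1,n):=1+\sum_{j=1}^{\min\{n+1,m+1\}}\binom{m+1}{j}$$ completed outer iterations.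
   Context: Notation. $\boldsymbol a_i^T$ is row $i$ of $A$; $\boldsymbol v_0:=\boldsymbol 0$, $\boldsymbol v_i:=\boldsymbol a_i$ for $1\le i\le m$; $\mathcal I:=\{0,\dots,m\}$; $\mathcal Q:=\operatorname{conv}\{\boldsymbol v_0,\dots,\boldsymbol v_m\}$; $\rho^*:=\max\{\rho\ge0:\rho\boldsymbol c\in\mathcal Q\}$. The dual of $(\mathrm P)$ is $\min\{\mathbf 1^T\boldsymbol u:A^T\boldsymbol u=\boldsymbol c,\boldsymbol u\ge\boldsymbol 0\}$, and a primal--dual optimum is a pair of optimal solutions of $(\mathrm P)$ and this dual. $\lVert\cdot\rVert$ is Euclidean. Wolfe's nearest-point subroutine. A corral is a nonempty $C\subseteq\mathcal I$ with $\{\boldsymbol v_i\}_{i\in C}$ affinely independent (for the indexed family) such that the point of $\operatorname{aff}\{\boldsymbol v_i:i\in C\}$ nearest to the target $\boldsymbol y$ is a convex combination of the $\boldsymbol v_i$, $i\in C$, with all weights strictly positive. $\mathrm{Wolfe}(\boldsymbol y;\mathcal I)$ starts from a single generator. Major step: at the current corral point $\boldsymbol z$, choose $j\in\mathcal I$ maximizing $(\boldsymbol y-\boldsymbol z)^T\boldsymbol v_j$ (ties broken deterministically); if this maximum is $\le(\boldsymbol y-\boldsymbol z)^T\boldsymbol z$, stop; otherwise insert $j$ with weight $0$. Minor steps: compute the affine weights $\boldsymbol\lambda^{\rm aff}$ (summing to one) of the nearest point to $\boldsymbol y$ in the affine hull of the active generators; if all are positive, they define the new corral point and a new major step begins; otherwise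 move from the current weights toward $\boldsymbol\lambda^{\rm aff}$ until a weight first becomes zero, delete zero-weight generators, and repeat. The output is $(\boldsymbol z,C,\boldsymbol\lambda_C)$: the Euclidean projection $\boldsymbol z$ of $\boldsymbol y$ onto $\mathcal Q$, the terminal corral $C$, and positive convex weights with $\boldsymbol z=\sum_{i\in C}\lambda_i\boldsymbol v_i$. P-LPN. Choose $\rho_0>\max_{i\in\mathcal I}\boldsymbol c^T\boldsymbol v_i$ and set $k=0$. At outer iteration $k$: put $\boldsymbol y_k:=\rho_k\boldsymbol c$ and $(\boldsymbol z_k,C_k,\boldsymbol\lambda^k_{C_k}):=\mathrm{Wolfe}(\boldsymbol y_k;\mathcal I)$. (a) If $\boldsymbol z_k=\boldsymbol y_k$: if $\rho_k=0$, return $\boldsymbol r:=\boldsymbol d_{k-1}/(\boldsymbol c^T\boldsymbol d_{k-1})$ as a recession direction (status unbounded); if $\rho_k\ne 0$, return $\boldsymbol x^*:=\boldsymbol d_{k-1}/h_{k-1}$ and $u_i^*:=\lambda_i^k/\rho_k$ $(1\le i\le m$, weights extended by zero outside $C_k)$ (status optimal). (b) Otherwise set $\boldsymbol d_k:=\boldsymbol y_k-\boldsymbol z_k$, $h_k:=\boldsymbol d_k^T\boldsymbol z_k=\max_{i\in\mathcal I}\boldsymbol d_k^T\boldsymbol v_i$. If $h_k=0$, return $\boldsymbol r:=\boldsymbol d_k/(\boldsymbol c^T\boldsymbol d_k)$ as a recession direction (status unbounded). Else set $\rho_{k+1}:=h_k/(\boldsymbol d_k^T\boldsymbol c)$, $k\leftarrow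 k+1$, and continue. (The returned quantities are also tested for the corresponding optimality or recession conditions.) Since $\boldsymbol y_0\notin\mathcal Q$, case (a) cannot occur at $k=0$. An outer iteration is completed once Wolfe has returned the projection and P-LPN has either stopped or chosen the next target; steps inside Wolfe are not counted. *)

theory Defs
  imports "HOL-Analysis.Analysis" "HOL-Library.While_Combinator"
begin

section \<open>The linear program and its generators\<close>

definition primal_feasible :: "real^'n^'m \<Rightarrow> real^'n \<Rightarrow> bool" where
  "primal_feasible A x \<longleftrightarrow> (\<forall>i. (A *v x) $ i \<le> 1)"

definition primal_optimal :: "real^'n^'m \<Rightarrow> real^'n \<Rightarrow> real^'n \<Rightarrow> bool" where
  "primal_optimal A c x \<longleftrightarrow>
     primal_feasible A x \<and> (\<forall>x'. primal_feasible A x' \<longrightarrow> c \<bullet> x' \<le> c \<bullet> x)"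

definition primal_unbounded :: "real^'n^'m \<Rightarrow> real^'n \<Rightarrow> bool" where
  "primal_unbounded A c \<longleftrightarrow> (\<forall>M. \<exists>x. primal_feasible A x \<and> M < c \<bullet> x)"

definition dual_feasible :: "real^'n^'m \<Rightarrow> real^'n \<Rightarrow> real^'m \<Rightarrow> bool" where
  "dual_feasible A c u \<longleftrightarrow> transpose A *v u = c \<and> (\<forall>i. 0 \<le> u $ i)"

definition dual_optimal :: "real^'n^'m \<Rightarrow> real^'n \<Rightarrow> real^'m \<Rightarrow> bool" where
  "dual_optimal A c u \<longleftrightarrow>
     dual_feasible A c u \<and>
     (\<forall>u'. dual_feasible A c u' \<longrightarrow> (\<Sum>i\<in>UNIV. u $ i) \<le> (\<Sum>i\<in>UNIV. u' $ i))"

text \<open>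
  The index set \<open>{0, \<dots>, m}\<close> is rendered by \<open>'m option\<close>: \<open>None\<close> is the index \<open>0\<close> of the
  additional generator \<open>0\<close>, and \<open>Some i\<close> is the index of row \<open>i\<close>.
\<close>

fun gen :: "real^'n^'m \<Rightarrow> 'm option \<Rightarrow> real^'n" where
  "gen A None = 0"
| "gen A (Some i) = row i A"

definition hullQ :: "real^'n^'m \<Rightarrow> (real^'n) set" where
  "hullQ A = convex hull (range (gen A))"

definition rho_star :: "real^'n^'m \<Rightarrow> real^'n \<Rightarrow> real" where
  "rho_star A c = (GREATEST \<rho>. 0 \<le> \<rho> \<and> \<rho> *\<^sub>R c \<in> hullQ A)"

definition supporting_normal :: "'a::real_inner set \<Rightarrow> 'a \<Rightarrow> 'a \<Rightarrow> bool" where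
  "supporting_normal S q d \<longleftrightarrow> d \<noteq> 0 \<and> q \<in> S \<and> (\<forall>w\<in>S. d \<bullet> w \<le> d \<bullet> q)"


section \<open>Wolfe's nearest-point subroutine\<close>

text \<open>
  Affine independence is that of the indexed family, so injectivity on \<open>C\<close> is required in
  addition to affine independence of the set of points.
\<close>

definition corral :: "('i \<Rightarrow> 'a::euclidean_space) \<Rightarrow> 'a \<Rightarrow> 'i set \<Rightarrow> bool" where
  "corral v y C \<longleftrightarrow>
     C \<noteq> {} \<and> inj_on v C \<and> \<not> affine_dependent (v ` C) \<and>
     (\<exists>w. (\<forall>i\<in>C. 0 < w i) \<and> sum w C = 1 \<and>
          (\<Sum>i\<in>C. w i *\<^sub>R v i) = closest_point (affine hull (v ` C)) y)"

text \<open>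
  The affine weights are extended by zero outside \<open>C\<close>. They are unique if the family indexed
  by \<open>C\<close> is affinely independent.
\<close>

definition affine_weights ::
    "('i \<Rightarrow> 'a::euclidean_space) \<Rightarrow> 'a \<Rightarrow> 'i set \<Rightarrow> 'i \<Rightarrow> real" where
  "affine_weights v y C =
     (THE w. (\<forall>i. i \<notin> C \<longrightarrow> w i = 0) \<and> sum w C = 1 \<and>
             (\<Sum>i\<in>C. w i *\<^sub>R v i) = closest_point (affine hull (v ` C)) y)"

text \<open>
  \<open>Major\<close>: at a corral point, before a major step; \<open>Minor\<close>: before a minor step;
  \<open>Stop\<close>: terminated. The weights vanish outside the active set.
\<close>

datatype 'i wolfe_state =
    Major (active: "'i set") (weights: "'i \<Rightarrow> real")
  | Minor (active: "'i set") (weights: "'i \<Rightarrow> real")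
  | Stop (active: "'i set") (weights: "'i \<Rightarrow> real")

definition wolfe_point :: "('i \<Rightarrow> 'a::euclidean_space) \<Rightarrow> 'i wolfe_state \<Rightarrow> 'a" where
  "wolfe_point v s = (\<Sum>i\<in>active s. weights s i *\<^sub>R v i)"

text \<open>
  A deterministic tie-breaking rule \<open>tie y s S\<close> selects one index from the set \<open>S\<close> of
  maximizers; it may depend on the target \<open>y\<close> and on the current state \<open>s\<close>.

  In a minor step, only a weight whose affine weight is nonpositive can reach zero on the way
  from \<open>w\<close> to \<open>a\<close>; this happens at the step length \<open>w i / (w i - a i)\<close>.
  (The index inserted last has current weight zero, but its affine weight is positive.)
\<close>

fun wolfe_step ::
    "('i::finite \<Rightarrow> 'a::euclidean_space) \<Rightarrow> ('a \<Rightarrow> 'i wolfe_state \<Rightarrow> 'i set \<Rightarrow> 'i) \<Rightarrow> 'a \<Rightarrow>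
     'i wolfe_state \<Rightarrow> 'i wolfe_state" where
  "wolfe_step v tie y (Major C w) =
     (let z = wolfe_point v (Major C w);
          j = tie y (Major C w) {j. \<forall>i. (y - z) \<bullet> v i \<le> (y - z) \<bullet> v j}
      in if (y - z) \<bullet> v j \<le> (y - z) \<bullet> z then Stop C w
         else Minor (insert j C) (w(j := 0)))"
| "wolfe_step v tie y (Minor C w) =
     (let a = affine_weights v y C
      in if \<forall>i\<in>C. 0 < a i then Major C a
         else
           let \<theta> = Min ((\<lambda>i. w i / (w i - a i)) ` {i\<in>C. a i \<le> 0});
               w' = (\<lambda>i. w i + \<theta> * (a i - w i))
           in Minor {i\<in>C. w' i \<noteq> 0} w')"
| "wolfe_step v tie y (Stop C w) = Stop C w"

text \<open>
  \<open>start y\<close> is the generator from which the call with target \<open>y\<close> starts. The result is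
  \<open>None\<close> if and only if the call does not terminate.
\<close>

definition wolfe ::
    "('i::finite \<Rightarrow> 'a::euclidean_space) \<Rightarrow> ('a \<Rightarrow> 'i wolfe_state \<Rightarrow> 'i set \<Rightarrow> 'i) \<Rightarrow>
     ('a \<Rightarrow> 'i) \<Rightarrow> 'a \<Rightarrow> ('a \<times> 'i set \<times> ('i \<Rightarrow> real)) option" where
  "wolfe v tie start y =
     map_option (\<lambda>s. (wolfe_point v s, active s, weights s))
       (while_option (\<lambda>s. \<not> is_Stop s) (wolfe_step v tie y)
          (Major {start y} (\<lambda>i. if i = start y then 1 else 0)))"


section \<open>The algorithm P-LPN\<close>

text \<open>
  \<open>Target \<rho> d h\<close>: an outer iteration with target \<open>\<rho> *\<^sub>R c\<close> is about to begin, where \<open>d\<close> and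
  \<open>h\<close> are the residual and the support value of the preceding outer iteration.
  \<open>Wolfe_Diverged\<close>: the Wolfe call of an outer iteration does not terminate.
\<close>

datatype ('x, 'u) plpn_state =
    Target real 'x real
  | Wolfe_Diverged
  | Return_Optimal 'x 'u
  | Return_Recession 'x

fun plpn_step ::
    "real^'n^'m \<Rightarrow> real^'n \<Rightarrow>
     (real^'n \<Rightarrow> 'm option wolfe_state \<Rightarrow> 'm option set \<Rightarrow> 'm option) \<Rightarrow>
     (real^'n \<Rightarrow> 'm option) \<Rightarrow>
     (real^'n, real^'m) plpn_state \<Rightarrow> (real^'n, real^'m) plpn_state" where
  "plpn_step A c tie start (Target \<rho> d h) =
     (let y = \<rho> *\<^sub>R c in
      case wolfe (gen A) tie start y of
        None \<Rightarrow> Wolfe_Diverged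
      | Some (z, C, w) \<Rightarrow>
          if z = y then
            (if \<rho> = 0 then Return_Recession (d /\<^sub>R (c \<bullet> d))
             else Return_Optimal (d /\<^sub>R h) (\<chi> i. w (Some i) / \<rho>))
          else
            (let d' = y - z; h' = d' \<bullet> z
             in if h' = 0 then Return_Recession (d' /\<^sub>R (c \<bullet> d'))
                else Target (h' / (d' \<bullet> c)) d' h'))"
| "plpn_step A c tie start s = s"

text \<open>
  The state after \<open>k\<close> outer iterations. The first iteration has no predecessor; the two zeros
  are dummies, which would be used only if \<open>\<rho>0 *\<^sub>R c\<close> were a point of \<open>hullQ A\<close>.
\<close>

definition plpn_iter ::
    "real^'n^'m \<Rightarrow> real^'n \<Rightarrow>
     (real^'n \<Rightarrow> 'm option wolfe_state \<Rightarrow> 'm option set \<Rightarrow> 'm option) \<Rightarrow>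
     (real^'n \<Rightarrow> 'm option) \<Rightarrow> real \<Rightarrow> nat \<Rightarrow> (real^'n, real^'m) plpn_state" where
  "plpn_iter A c tie start \<rho>0 k = (plpn_step A c tie start ^^ k) (Target \<rho>0 0 0)"

definition Kbound :: "nat \<Rightarrow> nat \<Rightarrow> nat" where
  "Kbound M n = 1 + (\<Sum>j = 1..min (n + 1) M. M choose j)"

end

theory Submission
  imports Defs
begin

text \<open>
  Wolfe's subroutine stops because the distance to the target strictly decreases from one corral
  point to the next, while a corral determines its point and there are finitely many corrals.

  The outer loop is Newton's method for the distance from \<open>\<rho> *\<^sub>R c\<close> to the generator hull:
  the next target is the point where the ray meets the hyperplane supporting the hull at the
  nearest point, so the scales decrease but never pass the optimal one. If an outer iteration
  chooses a further target, then its terminal corral occurs in no other such iteration. A corral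
  has between 1 and \<open>n + 1\<close> indices, and counting these sets bounds the number of iterations;
  the summand 1 accounts for the last iteration. At the end, the last residual supports the hull
  at the point found, and complementary slackness turns it into a primal solution or a recession
  direction.
\<close>

section \<open>Affine combinations of indexed families\<close>

definition affine_indep :: "('i \<Rightarrow> 'a::euclidean_space) \<Rightarrow> 'i set \<Rightarrow> bool" where
  "affine_indep v C \<longleftrightarrow> inj_on v C \<and> \<not> affine_dependent (v ` C)"

text \<open>Weights that vanish outside \<open>C\<close> are unique as functions, as the description
  in \<open>affine_weights\<close> demands, and one weight function can serve both before and after
  the active set changes.\<close>

definition affine_comb :: "('i \<Rightarrow> 'a::euclidean_space) \<Rightarrow> 'i set \<Rightarrow> ('i \<Rightarrow> real) \<Rightarrow> 'a \<Rightarrow> bool" where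
  "affine_comb v C w x \<longleftrightarrow>
     (\<forall>i. i \<notin> C \<longrightarrow> w i = 0) \<and> sum w C = 1 \<and> (\<Sum>i\<in>C. w i *\<^sub>R v i) = x"

abbreviation aff_proj :: "('i \<Rightarrow> 'a::euclidean_space) \<Rightarrow> 'i set \<Rightarrow> 'a \<Rightarrow> 'a" where
  "aff_proj v C y \<equiv> closest_point (affine hull (v ` C)) y"

lemma affine_indep_subset: "affine_indep v C \<Longrightarrow> D \<subseteq> C \<Longrightarrow> affine_indep v D"
  unfolding affine_indep_def by (meson affine_independent_subset image_mono inj_on_subset)

lemma affine_indep_insert:
  "affine_indep v C \<Longrightarrow> v j \<notin> affine hull (v ` C) \<Longrightarrow> affine_indep v (insert j C)"
  unfolding affine_indep_def
  by (simp add: affine_independent_insert) (metis Diff_subset hull_inc image_mono subsetD)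

lemma affine_indep_card_le:
  fixes v :: "'i::finite \<Rightarrow> 'a::euclidean_space"
  assumes "affine_indep v C"
  shows "card C \<le> DIM('a) + 1"
proof -
  have "card (v ` C) \<le> DIM('a) + 1"
    using assms affine_dependent_biggerset[of "v ` C"] unfolding affine_indep_def by fastforce
  then show ?thesis
    using assms card_image[of v C] unfolding affine_indep_def by simp
qed

text \<open>Carried over to the points by the inverse of \<open>v\<close> on \<open>C\<close>, the
  difference of two weight functions would be a nontrivial affine dependence.\<close>

lemma affine_comb_unique:
  fixes v :: "'i::finite \<Rightarrow> 'a::euclidean_space"
  assumes "affine_indep v C" "affine_comb v C a x" "affine_comb v C b x"
  shows "a = b"
proof (rule ccontr)
  assume "a \<noteq> b"
  have inj: "inj_on v C" using assms(1) by (simp add: affine_indep_def)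
  let ?g = "inv_into C v"
  let ?U = "\<lambda>p. a (?g p) - b (?g p)"
  from \<open>a \<noteq> b\<close> obtain i where i: "a i \<noteq> b i" by auto
  with assms(2,3) have "i \<in> C" unfolding affine_comb_def by metis
  have "sum ?U (v ` C) = (\<Sum>i\<in>C. a i - b i)"
    by (simp add: sum.reindex[OF inj] inj)
  also have "\<dots> = 0" using assms(2,3) by (simp add: affine_comb_def sum_subtractf)
  finally have 1: "sum ?U (v ` C) = 0" .
  have "(\<Sum>p\<in>v ` C. ?U p *\<^sub>R p) = (\<Sum>i\<in>C. (a i - b i) *\<^sub>R v i)"
    by (simp add: sum.reindex[OF inj] inj)
  also have "\<dots> = 0" using assms(2,3) by (simp add: affine_comb_def scaleR_diff_left sum_subtractf)
  finally have 2: "(\<Sum>p\<in>v ` C. ?U p *\<^sub>R p) = 0" .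
  have "?U (v i) \<noteq> 0" using i \<open>i \<in> C\<close> inj by simp
  with 1 2 \<open>i \<in> C\<close> have "affine_dependent (v ` C)"
    by (subst affine_dependent_explicit_finite) (auto intro!: exI[of _ ?U])
  with assms(1) show False by (simp add: affine_indep_def)
qed

lemma affine_comb_inner:
  "affine_comb v C w x \<Longrightarrow> d \<bullet> x = (\<Sum>i\<in>C. w i * (d \<bullet> v i))"
  unfolding affine_comb_def by (auto simp: inner_sum_right)

lemma affine_comb_inner_diff:
  assumes "affine_comb v C w x"
  shows "d \<bullet> (x - p) = (\<Sum>i\<in>C. w i * (d \<bullet> (v i - p)))"
proof -
  have "d \<bullet> p = (\<Sum>i\<in>C. w i * (d \<bullet> p))"
    using assms by (simp add: affine_comb_def flip: sum_distrib_right)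
  then show ?thesis
    using affine_comb_inner[OF assms, of d]
    by (simp add: inner_diff_right right_diff_distrib sum_subtractf)
qed

lemma affine_comb_mem:
  fixes v :: "'i::finite \<Rightarrow> 'a::euclidean_space"
  assumes "affine_indep v C" "affine_comb v C w x"
  shows "x \<in> affine hull (v ` C)"
proof -
  have inj: "inj_on v C" using assms(1) by (simp add: affine_indep_def)
  have "sum (w \<circ> inv_into C v) (v ` C) = 1 \<and> (\<Sum>p\<in>v ` C. (w \<circ> inv_into C v) p *\<^sub>R p) = x"
    using assms(2) by (simp add: sum.reindex[OF inj] inj affine_comb_def)
  then show ?thesis by (subst affine_hull_finite) auto
qed

lemma affine_comb_exists:
  fixes v :: "'i::finite \<Rightarrow> 'a::euclidean_space"
  assumes "affine_indep v C" "x \<in> affine hull (v ` C)"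
  shows "\<exists>w. affine_comb v C w x"
proof -
  have inj: "inj_on v C" using assms(1) by (simp add: affine_indep_def)
  obtain u where u: "sum u (v ` C) = 1" "(\<Sum>p\<in>v ` C. u p *\<^sub>R p) = x"
    using assms(2) by (subst (asm) affine_hull_finite) auto
  have "affine_comb v C (\<lambda>i. if i \<in> C then u (v i) else 0) x"
    using u by (simp add: affine_comb_def sum.reindex[OF inj])
  then show ?thesis by blast
qed

lemma affine_comb_affine_weights:
  fixes v :: "'i::finite \<Rightarrow> 'a::euclidean_space"
  assumes "affine_indep v C" "C \<noteq> {}"
  shows "affine_comb v C (affine_weights v y C) (aff_proj v C y)"
proof -
  have "aff_proj v C y \<in> affine hull (v ` C)"
    using assms(2) by (intro closest_point_in_set) auto
  then have "\<exists>!w. affine_comb v C w (aff_proj v C y)"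
    using affine_comb_exists affine_comb_unique assms(1) by metis
  then show ?thesis
    unfolding affine_comb_def affine_weights_def by (rule theI')
qed

lemma affine_comb_step:
  assumes "affine_comb v C w z" "affine_comb v C a x"
  shows "affine_comb v C (\<lambda>i. w i + \<theta> * (a i - w i)) (z + \<theta> *\<^sub>R (x - z))"
  using assms unfolding affine_comb_def
  by (auto simp: sum.distrib sum_subtractf algebra_simps scaleR_sum_right simp flip: sum_distrib_left)

lemma affine_comb_support:
  fixes C :: "'i::finite set"
  assumes "affine_comb v C w z"
  shows "affine_comb v {i \<in> C. w i \<noteq> 0} w z"
proof -
  have "sum w {i \<in> C. w i \<noteq> 0} = sum w C"
    "(\<Sum>i\<in>{i \<in> C. w i \<noteq> 0}. w i *\<^sub>R v i) = (\<Sum>i\<in>C. w i *\<^sub>R v i)"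
    by (auto intro: sum.mono_neutral_left)
  with assms show ?thesis unfolding affine_comb_def by auto
qed

text \<open>The variational inequality for the closest point, used at \<open>x\<close> and at the
  mirror image of \<open>x\<close> in that point, gives both signs.\<close>

lemma closest_point_affine_orthogonal:
  fixes S :: "'a::euclidean_space set"
  assumes "affine S" "closed S" "x \<in> S"
  shows "(y - closest_point S y) \<bullet> (x - closest_point S y) = 0"
proof -
  let ?p = "closest_point S y"
  have p: "?p \<in> S" using assms by (intro closest_point_in_set) auto
  have "2 *\<^sub>R ?p + (-1) *\<^sub>R x \<in> S"
    using assms(1,3) p unfolding affine_def by (metis add.commute uminus_add_conv_diff one_add_one add_diff_cancel_left')
  from closest_point_dot[OF affine_imp_convex[OF assms(1)] assms(2) this, of y]
  have "(y - ?p) \<bullet> (?p - x) \<le> 0"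
    by (simp add: scaleR_2 algebra_simps)
  moreover have "(y - ?p) \<bullet> (x - ?p) \<le> 0"
    by (rule closest_point_dot[OF affine_imp_convex[OF assms(1)] assms(2,3)])
  ultimately show ?thesis by (simp add: inner_diff_right)
qed

lemma dist_segment_le:
  fixes y :: "'a::real_normed_vector"
  assumes "0 \<le> \<theta>" "\<theta> \<le> 1"
  shows "dist y (z + \<theta> *\<^sub>R (x - z)) \<le> (1 - \<theta>) * dist y z + \<theta> * dist y x"
proof -
  have "y - (z + \<theta> *\<^sub>R (x - z)) = (1 - \<theta>) *\<^sub>R (y - z) + \<theta> *\<^sub>R (y - x)"
    by (simp add: algebra_simps)
  then show ?thesis
    using norm_triangle_ineq[of "(1 - \<theta>) *\<^sub>R (y - z)" "\<theta> *\<^sub>R (y - x)"] assms by (simp add: dist_norm)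
qed

section \<open>Termination of Wolfe's subroutine\<close>

text \<open>The old residual \<open>y - z\<close> is orthogonal to the old hull, so only the term of
  \<open>j\<close> survives when its product with the displacement from \<open>z\<close> to the new
  projection is expanded in generators. This product is also the squared length of the displacement,
  hence positive. So a freshly inserted index, though of weight zero, heads for a positive
  weight.\<close>

lemma insertion_progress:
  fixes v :: "'i::finite \<Rightarrow> 'a::euclidean_space"
  assumes "affine_indep v C" "affine_comb v C w z" "affine_comb v C a (aff_proj v C y)" "j \<in> C"
    and proj: "z = aff_proj v (C - {j}) y"
    and j: "0 < (y - z) \<bullet> (v j - z)"
  shows "0 < a j" "dist y (aff_proj v C y) < dist y z"
proof -
  let ?S = "affine hull (v ` C)" and ?x = "aff_proj v C y"
  have zS: "z \<in> ?S" using assms affine_comb_mem by blast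
  have vS: "v j \<in> ?S" using assms(4) by (simp add: hull_inc)
  note orthS = closest_point_affine_orthogonal[OF affine_affine_hull closed_affine_hull]
  have orth: "(y - z) \<bullet> (v i - z) = 0" if "i \<in> C - {j}" for i
    using that orthS[of "v i" "v ` (C - {j})" y] unfolding proj by (simp add: hull_inc)
  \<comment> \<open>If the projection did not move, its residual would be orthogonal to
    \<open>v j - z\<close> too, against \<open>j\<close>.\<close>
  have ne: "?x \<noteq> z"
    using orthS[OF vS, of y] j by auto
  show "dist y ?x < dist y z"
    using closest_point_lt[of ?S z y] zS ne by (auto simp: affine_imp_convex)
  \<comment> \<open>The new residual \<open>y - ?x\<close> is orthogonal to \<open>z - ?x\<close>,
    because \<open>z\<close> lies in the larger hull.\<close>
  have "(?x - z) \<bullet> (?x - z) = (y - z) \<bullet> (?x - z)"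
    using orthS[OF zS, of y] by (simp add: algebra_simps inner_commute)
  also have "\<dots> = (\<Sum>i\<in>C. a i * ((y - z) \<bullet> (v i - z)))"
    by (rule affine_comb_inner_diff[OF assms(3)])
  also have "\<dots> = a j * ((y - z) \<bullet> (v j - z)) + (\<Sum>i\<in>C - {j}. a i * ((y - z) \<bullet> (v i - z)))"
    by (rule sum.remove) (use assms(4) in auto)
  also have "\<dots> = a j * ((y - z) \<bullet> (v j - z))" using orth by simp
  finally have "0 < a j * ((y - z) \<bullet> (v j - z))" using ne
    by (metis inner_gt_zero_iff right_minus_eq)
  with j show "0 < a j" by (simp add: zero_less_mult_iff)
qed

text \<open>A ratio test as in the simplex method: an index attaining the minimum reaches zero
  exactly, and no weight has become negative by then. Positive weights at all blocking candidates
  make the step length positive.\<close>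

lemma minor_step_length:
  fixes C :: "'i::finite set" and w a :: "'i \<Rightarrow> real"
  defines "\<theta> \<equiv> Min ((\<lambda>i. w i / (w i - a i)) ` {i\<in>C. a i \<le> 0})"
  assumes nonempty: "\<exists>i\<in>C. a i \<le> 0"
    and pos: "\<And>i. i \<in> C \<Longrightarrow> a i \<le> 0 \<Longrightarrow> 0 < w i"
    and nonneg: "\<And>i. i \<in> C \<Longrightarrow> 0 \<le> w i"
  shows "0 < \<theta>" "\<theta> \<le> 1" "\<And>i. i \<in> C \<Longrightarrow> 0 \<le> w i + \<theta> * (a i - w i)"
    "\<exists>i\<in>C. w i + \<theta> * (a i - w i) = 0"
proof -
  let ?T = "{i\<in>C. a i \<le> 0}" and ?r = "\<lambda>i. w i / (w i - a i)"
  have fin: "finite (?r ` ?T)" and ne: "?r ` ?T \<noteq> {}" using nonempty by auto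
  have le: "\<theta> \<le> ?r i" if "i \<in> ?T" for i
    unfolding \<theta>_def using that by (intro Min_le) auto
  obtain k where k: "k \<in> ?T" "\<theta> = ?r k"
    using Min_in[OF fin ne] unfolding \<theta>_def by blast
  have kw: "0 < w k" "a k \<le> 0" using k pos by auto
  show pos\<theta>: "0 < \<theta>" using k(2) kw by simp
  show le1: "\<theta> \<le> 1" using k(2) kw by simp
  show "\<exists>i\<in>C. w i + \<theta> * (a i - w i) = 0"
    using k kw by (intro bexI[of _ k]) (auto simp: field_simps)
  show "0 \<le> w i + \<theta> * (a i - w i)" if "i \<in> C" for i
  proof (cases "a i \<le> 0")
    case True
    then have "0 < w i - a i" using pos that by fastforce
    then have "\<theta> * (w i - a i) \<le> w i"
      using le[of i] True that by (simp add: pos_le_divide_eq)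
    then show ?thesis by (simp add: algebra_simps)
  next
    case False
    \<comment> \<open>With a positive affine weight, the new weight is a convex combination of
      nonnegative numbers.\<close>
    have "w i + \<theta> * (a i - w i) = (1 - \<theta>) * w i + \<theta> * a i" by (simp add: algebra_simps)
    then show ?thesis using False le1 pos\<theta> nonneg[OF that] by simp
  qed
qed

section \<open>Invariant and rank of Wolfe states\<close>

text \<open>A minor state either has positive weights only, as after a deletion, or is fresh from an
  insertion. In the fresh case the point is still the projection for the old active set and the
  residual has a positive component towards the new generator, which is the input of
  \<open>insertion_progress\<close>.\<close>

fun wolfe_inv :: "('i::finite \<Rightarrow> 'a::euclidean_space) \<Rightarrow> 'a \<Rightarrow> 'i wolfe_state \<Rightarrow> bool" where
  "wolfe_inv v y (Major C w) \<longleftrightarrow>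
     affine_indep v C \<and> affine_comb v C w (aff_proj v C y) \<and> (\<forall>i\<in>C. 0 < w i)"
| "wolfe_inv v y (Minor C w) \<longleftrightarrow>
     affine_indep v C \<and>
     (\<exists>z. affine_comb v C w z \<and>
       ((\<forall>i\<in>C. 0 < w i) \<or>
        (\<exists>j\<in>C. w j = 0 \<and> z = aff_proj v (C - {j}) y \<and> 0 < (y - z) \<bullet> (v j - z) \<and>
           (\<forall>i\<in>C - {j}. 0 < w i))))"
| "wolfe_inv v y (Stop C w) \<longleftrightarrow>
     affine_indep v C \<and> affine_comb v C w (aff_proj v C y) \<and> (\<forall>i\<in>C. 0 < w i) \<and>
     (\<forall>i. (y - aff_proj v C y) \<bullet> v i \<le> (y - aff_proj v C y) \<bullet> aff_proj v C y)"

text \<open>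
  Only the finitely many distances from the target to affine hulls of generators occur at corral
  points. The level counts those not exceeding the current distance; it never increases and
  drops on the step after an insertion, and between two drops the phase decreases.
\<close>

definition wolfe_level :: "('i::finite \<Rightarrow> 'a::euclidean_space) \<Rightarrow> 'a \<Rightarrow> 'a \<Rightarrow> nat" where
  "wolfe_level v y z = card {t \<in> range (\<lambda>C. dist y (aff_proj v C y)). t \<le> dist y z}"

text \<open>At an unchanged point, a major state leads to \<open>Stop\<close> or to a fresh minor
  state, so these two rank below it. A minor state without zero weights must rank above the major
  state it may become and decrease with its active set.\<close>

fun wolfe_phase :: "'i::finite wolfe_state \<Rightarrow> nat" where
  "wolfe_phase (Major C w) = 2"
| "wolfe_phase (Minor C w) = (if \<exists>i\<in>C. w i = 0 then 1 else 3 + card C)"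
| "wolfe_phase (Stop C w) = 0"

text \<open>The lexicographic order of level and phase in a single number: the factor exceeds every
  phase.\<close>

definition wolfe_rank :: "('i::finite \<Rightarrow> 'a::euclidean_space) \<Rightarrow> 'a \<Rightarrow> 'i wolfe_state \<Rightarrow> nat" where
  "wolfe_rank v y s =
     wolfe_level v y (wolfe_point v s) * (4 + CARD('i)) + wolfe_phase s"

lemma wolfe_level_mono: "dist y z' \<le> dist y z \<Longrightarrow> wolfe_level v y z' \<le> wolfe_level v y z"
  unfolding wolfe_level_def by (intro card_mono) auto

text \<open>The distance of a projection is itself one of the counted values, so it leaves the count
  as soon as the distance falls below it.\<close>

lemma wolfe_level_strict:
  assumes "dist y z' < dist y (aff_proj v C y)"
  shows "wolfe_level v y z' < wolfe_level v y (aff_proj v C y)"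
proof -
  let ?A = "\<lambda>z. {t \<in> range (\<lambda>C. dist y (aff_proj v C y)). t \<le> dist y z}"
  have "dist y (aff_proj v C y) \<in> ?A (aff_proj v C y) - ?A z'" using assms by auto
  moreover have "?A z' \<subseteq> ?A (aff_proj v C y)" using assms by auto
  ultimately have "?A z' \<subset> ?A (aff_proj v C y)" by blast
  then show ?thesis unfolding wolfe_level_def by (intro psubset_card_mono) auto
qed

lemma wolfe_phase_less: "wolfe_phase (s :: 'i::finite wolfe_state) < 4 + CARD('i)"
proof -
  have "card C \<le> CARD('i)" for C :: "'i set" by (simp add: card_mono)
  then show ?thesis
    by (cases s) (auto simp: less_Suc_eq_le)
qed

lemma wolfe_rank_less_level:
  fixes v :: "'i::finite \<Rightarrow> 'a::euclidean_space"
  assumes "wolfe_level v y (wolfe_point v s') < wolfe_level v y (wolfe_point v s)"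
  shows "wolfe_rank v y s' < wolfe_rank v y s"
proof -
  have "wolfe_rank v y s' < Suc (wolfe_level v y (wolfe_point v s')) * (4 + CARD('i))"
    using wolfe_phase_less[of s'] by (simp add: wolfe_rank_def)
  also have "\<dots> \<le> wolfe_level v y (wolfe_point v s) * (4 + CARD('i))"
    using assms by (intro mult_right_mono) auto
  finally show ?thesis by (simp add: wolfe_rank_def)
qed

lemma wolfe_rank_less_phase:
  assumes "wolfe_level v y (wolfe_point v s') \<le> wolfe_level v y (wolfe_point v s)"
    and "wolfe_phase s' < wolfe_phase s"
  shows "wolfe_rank v y s' < wolfe_rank v y s"
  unfolding wolfe_rank_def using assms by (intro add_le_less_mono mult_right_mono) auto

lemma wolfe_point_comb:
  "affine_comb v (active s) (weights s) z \<Longrightarrow> wolfe_point v s = z"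
  by (simp add: wolfe_point_def affine_comb_def)

lemma wolfe_start:
  "wolfe_inv v y (Major {i} (\<lambda>k. if k = i then 1 else 0))"
proof -
  have "closest_point {v i} y = v i"
    using closest_point_in_set[of "{v i}" y] by simp
  then show ?thesis by (simp add: affine_indep_def affine_comb_def)
qed

section \<open>Major and minor steps\<close>

text \<open>A major step does not move the point, so only the phase has to drop. A generator passing
  the test lies off the current affine hull, where the residual is orthogonal; hence insertion keeps
  affine independence.\<close>

lemma wolfe_major_step:
  fixes v :: "'i::finite \<Rightarrow> 'a::euclidean_space"
  assumes tie: "\<And>y s S. S \<noteq> {} \<Longrightarrow> tie y s S \<in> S"
    and inv: "wolfe_inv v y (Major C w)"
  shows "wolfe_inv v y (wolfe_step v tie y (Major C w)) \<and>
    wolfe_rank v y (wolfe_step v tie y (Major C w)) < wolfe_rank v y (Major C w)"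
proof -
  define z where "z = aff_proj v C y"
  define j where "j = tie y (Major C w) {j. \<forall>i. (y - z) \<bullet> v i \<le> (y - z) \<bullet> v j}"
  have inv': "affine_indep v C" "affine_comb v C w z" "\<forall>i\<in>C. 0 < w i"
    using inv by (auto simp: z_def)
  have pt: "wolfe_point v (Major C w) = z"
    using inv'(2) by (simp add: wolfe_point_comb)
  let ?f = "\<lambda>i. (y - z) \<bullet> v i"
  \<comment> \<open>A finite family has a maximizer, so the tie-breaking rule is applied to a
    nonempty set.\<close>
  have "Max (range ?f) \<in> range ?f" by (rule Max_in) auto
  then obtain k where k: "Max (range ?f) = ?f k" by (rule imageE)
  have "?f i \<le> ?f k" for i
    unfolding k[symmetric] by (rule Max_ge) auto
  then have ne: "{j. \<forall>i. (y - z) \<bullet> v i \<le> (y - z) \<bullet> v j} \<noteq> {}" by blast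
  have jmax: "(y - z) \<bullet> v i \<le> (y - z) \<bullet> v j" for i
    using tie[OF ne, of y "Major C w"] unfolding j_def by blast
  have step: "wolfe_step v tie y (Major C w) =
      (if (y - z) \<bullet> v j \<le> (y - z) \<bullet> z then Stop C w else Minor (insert j C) (w(j := 0)))"
    by (simp add: pt Let_def flip: j_def)
  show ?thesis
  proof (cases "(y - z) \<bullet> v j \<le> (y - z) \<bullet> z")
    case True
    then have "\<forall>i. (y - z) \<bullet> v i \<le> (y - z) \<bullet> z" using jmax order_trans by blast
    moreover have "wolfe_point v (Stop C w) = z"
      using inv'(2) by (simp add: wolfe_point_comb)
    ultimately show ?thesis
      using True step inv' by (auto simp: pt simp flip: z_def intro!: wolfe_rank_less_phase)
  next
    case False
    then have pos: "0 < (y - z) \<bullet> (v j - z)" by (simp add: inner_diff_right)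
    have nmem: "v j \<notin> affine hull (v ` C)"
      using closest_point_affine_orthogonal[OF affine_affine_hull closed_affine_hull, of "v j" _ y] pos
      unfolding z_def by force
    then have "j \<notin> C" using hull_inc[of "v j" "v ` C" affine] by auto
    then have "w(j := 0) = w" using inv'(2) by (auto simp: affine_comb_def)
    with False step have step': "wolfe_step v tie y (Major C w) = Minor (insert j C) w" by simp
    have comb: "affine_comb v (insert j C) w z"
      using inv'(2) \<open>j \<notin> C\<close> by (auto simp: affine_comb_def)
    have wj: "w j = 0" using inv'(2) \<open>j \<notin> C\<close> by (auto simp: affine_comb_def)
    have "wolfe_inv v y (Minor (insert j C) w)"
      using comb affine_indep_insert[OF inv'(1) nmem] pos inv'(3) wj \<open>j \<notin> C\<close>
      by (auto intro!: exI[of _ z] simp: z_def)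
    moreover have "wolfe_point v (Minor (insert j C) w) = z"
      using comb by (simp add: wolfe_point_comb)
    ultimately show ?thesis
      unfolding step' using wj by (auto simp: pt intro!: wolfe_rank_less_phase)
  qed
qed

text \<open>Moving towards the projection never increases the distance. Right after an insertion the
  distance drops strictly and with it the level; otherwise the step reaches a corral or deletes an
  index, and the phase drops.\<close>

lemma wolfe_minor_step:
  fixes v :: "'i::finite \<Rightarrow> 'a::euclidean_space"
  assumes inv: "wolfe_inv v y (Minor C w)"
  shows "wolfe_inv v y (wolfe_step v tie y (Minor C w)) \<and>
    wolfe_rank v y (wolfe_step v tie y (Minor C w)) < wolfe_rank v y (Minor C w)"
proof -
  define a where "a = affine_weights v y C"
  define x where "x = aff_proj v C y"
  obtain z where ind: "affine_indep v C" and comb: "affine_comb v C w z"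
    and cases: "(\<forall>i\<in>C. 0 < w i) \<or>
        (\<exists>j\<in>C. w j = 0 \<and> z = aff_proj v (C - {j}) y \<and> 0 < (y - z) \<bullet> (v j - z) \<and>
           (\<forall>i\<in>C - {j}. 0 < w i))"
    using inv by auto
  have "C \<noteq> {}" using comb by (auto simp: affine_comb_def)
  then have a: "affine_comb v C a x"
    unfolding a_def x_def by (rule affine_comb_affine_weights[OF ind])
  have pt: "wolfe_point v (Minor C w) = z" using comb by (simp add: wolfe_point_comb)
  have le: "dist y x \<le> dist y z"
    unfolding x_def using affine_comb_mem[OF ind comb] by (intro closest_point_le) auto
  have nonneg: "0 \<le> w i" if "i \<in> C" for i using cases that by (metis DiffI less_imp_le order_refl singletonD)
  \<comment> \<open>The fresh index has weight zero but cannot block the step, since its affine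
    weight is positive.\<close>
  have pos: "0 < w i" if "i \<in> C" "a i \<le> 0" for i
    using cases
  proof
    assume "\<exists>j\<in>C. w j = 0 \<and> z = aff_proj v (C - {j}) y \<and> 0 < (y - z) \<bullet> (v j - z) \<and>
      (\<forall>i\<in>C - {j}. 0 < w i)"
    then obtain j where j: "j \<in> C" "z = aff_proj v (C - {j}) y" "0 < (y - z) \<bullet> (v j - z)"
      "\<forall>i\<in>C - {j}. 0 < w i" by blast
    have "0 < a j"
      using insertion_progress(1)[OF ind comb _ j(1-3)] a unfolding x_def by blast
    with that j(4) show ?thesis by force
  qed (use that in blast)
  have strict: "dist y x < dist y z \<and> (\<exists>D. z = aff_proj v D y)" if zero: "\<exists>i\<in>C. w i = 0"
  proof -
    have "\<not> (\<forall>i\<in>C. 0 < w i)" using zero by force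
    then obtain j where j: "j \<in> C" "z = aff_proj v (C - {j}) y" "0 < (y - z) \<bullet> (v j - z)"
      using cases by blast
    then show ?thesis
      using insertion_progress(2)[OF ind comb _ j(1-3)] a unfolding x_def by blast
  qed
  \<comment> \<open>Covers both outcomes at once: \<open>p\<close> is either the projection
    \<open>x\<close> or a point short of it that inherits any strict gain made at
    \<open>x\<close>.\<close>
  have rank: "wolfe_rank v y s < wolfe_rank v y (Minor C w)"
    if s: "wolfe_point v s = p" and le: "dist y p \<le> dist y z"
      and less: "dist y x < dist y z \<Longrightarrow> dist y p < dist y z"
      and phase: "wolfe_phase s < 3 + card C" for s p
  proof (cases "\<exists>i\<in>C. w i = 0")
    case True
    with strict less obtain D where "dist y p < dist y z" "z = aff_proj v D y" by blast
    then have "wolfe_level v y p < wolfe_level v y z" using wolfe_level_strict by blast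
    then show ?thesis by (intro wolfe_rank_less_level) (simp add: s pt)
  next
    case False
    then show ?thesis
      using phase wolfe_level_mono[OF le] by (intro wolfe_rank_less_phase) (auto simp: s pt)
  qed
  show ?thesis
  proof (cases "\<forall>i\<in>C. 0 < a i")
    case True
    then have step: "wolfe_step v tie y (Minor C w) = Major C a"
      by (simp add: Let_def flip: a_def)
    have "wolfe_point v (Major C a) = x" using a by (simp add: wolfe_point_comb)
    then have "wolfe_rank v y (Major C a) < wolfe_rank v y (Minor C w)"
      using le by (intro rank) auto
    then show ?thesis unfolding step using True a ind by (simp add: x_def)
  next
    case False
    define \<theta> where "\<theta> = Min ((\<lambda>i. w i / (w i - a i)) ` {i\<in>C. a i \<le> 0})"
    define w' where "w' = (\<lambda>i. w i + \<theta> * (a i - w i))"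
    define D where "D = {i\<in>C. w' i \<noteq> 0}"
    define z' where "z' = z + \<theta> *\<^sub>R (x - z)"
    have step: "wolfe_step v tie y (Minor C w) = Minor D w'"
      using False by (auto simp: Let_def D_def w'_def \<theta>_def simp flip: a_def)
    have "\<exists>i\<in>C. a i \<le> 0" using False by force
    from minor_step_length[of C a w, OF this pos nonneg, folded \<theta>_def]
    have \<theta>: "0 < \<theta>" "\<theta> \<le> 1" and w'_nonneg: "\<And>i. i \<in> C \<Longrightarrow> 0 \<le> w' i"
      and w'_zero: "\<exists>i\<in>C. w' i = 0"
      unfolding w'_def by auto
    have comb': "affine_comb v D w' z'"
      unfolding D_def z'_def
      by (rule affine_comb_support) (use affine_comb_step[OF comb a] in \<open>simp add: w'_def\<close>)
    have Dpos: "\<forall>i\<in>D. 0 < w' i" using w'_nonneg by (force simp: D_def)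
    have "D \<subset> C" using w'_zero by (auto simp: D_def)
    then have "card D < card C" by (simp add: psubset_card_mono)
    \<comment> \<open>The distance is convex along the segment, so a positive
      \<open>\<theta>\<close> passes a strict gain at \<open>x\<close> on to
      \<open>z'\<close>.\<close>
    have "dist y z' \<le> (1 - \<theta>) * dist y z + \<theta> * dist y x"
      unfolding z'_def using \<theta> by (intro dist_segment_le) auto
    then have dist': "dist y z' \<le> dist y z - \<theta> * (dist y z - dist y x)"
      by (simp add: algebra_simps)
    have "wolfe_rank v y (Minor D w') < wolfe_rank v y (Minor C w)"
    proof (rule rank)
      show "wolfe_point v (Minor D w') = z'" using comb' by (simp add: wolfe_point_comb)
      have "0 \<le> \<theta> * (dist y z - dist y x)" using \<theta> le by simp
      with dist' show "dist y z' \<le> dist y z" by linarith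
      show "dist y z' < dist y z" if "dist y x < dist y z"
      proof -
        have "0 < \<theta> * (dist y z - dist y x)" using \<theta> that by simp
        with dist' show ?thesis by linarith
      qed
      show "wolfe_phase (Minor D w') < 3 + card C" using \<open>card D < card C\<close> by simp
    qed
    moreover have "wolfe_inv v y (Minor D w')"
      using comb' Dpos affine_indep_subset[OF ind] \<open>D \<subset> C\<close> by auto
    ultimately show ?thesis unfolding step by blast
  qed
qed

section \<open>Termination and correctness of a Wolfe call\<close>

lemma wolfe_terminates:
  fixes v :: "'i::finite \<Rightarrow> 'a::euclidean_space"
  assumes tie: "\<And>y s S. S \<noteq> {} \<Longrightarrow> tie y s S \<in> S"
  shows "\<exists>C w. wolfe v tie start y = Some (wolfe_point v (Stop C w), C, w) \<and>
    wolfe_inv v y (Stop C w)"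
proof -
  let ?s = "Major {start y} (\<lambda>i. if i = start y then 1 else 0)"
  let ?b = "\<lambda>s. \<not> is_Stop s"
  have step: "wolfe_inv v y (wolfe_step v tie y s) \<and> wolfe_rank v y (wolfe_step v tie y s) < wolfe_rank v y s"
    if "wolfe_inv v y s" "?b s" for s
    using that wolfe_major_step[OF tie] wolfe_minor_step by (cases s) fastforce+
  obtain t where t: "while_option ?b (wolfe_step v tie y) ?s = Some t"
    using measure_while_option_Some[of "wolfe_inv v y" ?b "wolfe_step v tie y" "wolfe_rank v y" ?s]
      step wolfe_start by blast
  have "wolfe_inv v y t"
    using while_option_rule[of "wolfe_inv v y", OF _ t] step wolfe_start by blast
  moreover have "is_Stop t" using while_option_stop[OF t] by simp
  ultimately show ?thesis
    using t by (cases t) (auto simp: wolfe_def)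
qed

text \<open>The stopping test bounds a linear functional on the generators, hence on their convex
  hull, and this is the variational inequality of the nearest point. The same bound provides the
  supporting hyperplane for the outer loop.\<close>

lemma wolfe_correct:
  fixes v :: "'i::finite \<Rightarrow> 'a::euclidean_space"
  assumes "\<And>y s S. S \<noteq> {} \<Longrightarrow> tie y s S \<in> S"
  obtains z C w where "wolfe v tie start y = Some (z, C, w)"
    "z = closest_point (convex hull (range v)) y" "corral v y C"
    "\<forall>i\<in>C. 0 < w i" "\<forall>i. i \<notin> C \<longrightarrow> w i = 0" "sum w C = 1" "z = (\<Sum>i\<in>C. w i *\<^sub>R v i)"
    "\<forall>i. (y - z) \<bullet> v i \<le> (y - z) \<bullet> z"
proof -
  have "\<exists>C w. wolfe v tie start y = Some (wolfe_point v (Stop C w), C, w) \<and>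
    wolfe_inv v y (Stop C w)"
    by (rule wolfe_terminates) (rule assms)
  then obtain C w where eq: "wolfe v tie start y = Some (wolfe_point v (Stop C w), C, w)"
    and inv: "wolfe_inv v y (Stop C w)"
    by (elim exE conjE)
  define z where "z = aff_proj v C y"
  have comb: "affine_comb v C w z" and ind: "affine_indep v C" and pos: "\<forall>i\<in>C. 0 < w i"
    and opt: "\<forall>i. (y - z) \<bullet> v i \<le> (y - z) \<bullet> z"
    using inv by (auto simp: z_def)
  have w: "\<forall>i. i \<notin> C \<longrightarrow> w i = 0" "sum w C = 1" "(\<Sum>i\<in>C. w i *\<^sub>R v i) = z"
    using comb by (auto simp: affine_comb_def)
  have "C \<noteq> {}" using w(2) by auto
  then have corral: "corral v y C"
    using ind pos w unfolding corral_def affine_indep_def z_def by blast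
  let ?Q = "convex hull (range v)"
  have mem: "z \<in> ?Q"
    unfolding w(3)[symmetric]
    by (rule convex_sum) (use w(2) pos in \<open>auto intro: hull_inc less_imp_le\<close>)
  have supp: "(y - z) \<bullet> p \<le> (y - z) \<bullet> z" if "p \<in> ?Q" for p
  proof -
    have "?Q \<subseteq> {p. (y - z) \<bullet> p \<le> (y - z) \<bullet> z}"
      by (rule hull_minimal) (use opt in \<open>auto simp: convex_halfspace_le\<close>)
    with that show ?thesis by blast
  qed
  have "z = closest_point ?Q y"
  proof (rule closest_point_unique)
    show "closed ?Q" by (simp add: compact_imp_closed finite_imp_compact_convex_hull)
    show "\<forall>p\<in>?Q. dist y z \<le> dist y p"
    proof
      fix p assume "p \<in> ?Q"
      \<comment> \<open>Cauchy-Schwarz turns the variational inequality into a comparison of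
        distances.\<close>
      have "(y - z) \<bullet> (p - z) \<le> 0" using supp[OF \<open>p \<in> ?Q\<close>] by (simp add: inner_diff_right)
      then have "(y - z) \<bullet> (y - z) \<le> (y - z) \<bullet> (y - p)" by (simp add: inner_diff_right)
      also have "\<dots> \<le> norm (y - z) * norm (y - p)" by (rule norm_cauchy_schwarz)
      finally have "norm (y - z) * norm (y - z) \<le> norm (y - z) * norm (y - p)"
        by (metis norm_eq_square power2_norm_eq_inner power2_eq_square)
      then show "dist y z \<le> dist y p"
        by (cases "y = z") (auto simp: dist_norm)
    qed
  qed (use mem in auto)
  moreover have "wolfe_point v (Stop C w) = z" using comb by (simp add: wolfe_point_comb)
  ultimately show thesis using that[of z C w] eq corral pos w opt by auto
qed

section \<open>Outer iterations\<close>

lemma linear_le_on_hullQ: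
  assumes "\<And>i. d \<bullet> gen A i \<le> h" "p \<in> hullQ A"
  shows "d \<bullet> p \<le> h"
proof -
  have "hullQ A \<subseteq> {p. d \<bullet> p \<le> h}"
    unfolding hullQ_def by (rule hull_minimal) (use assms(1) in \<open>auto simp: convex_halfspace_le\<close>)
  with assms(2) show ?thesis by blast
qed

lemma zero_in_hullQ: "0 \<in> hullQ A"
  unfolding hullQ_def by (metis gen.simps(1) hull_inc rangeI)

text \<open>Evaluating \<open>d\<close> at another admissible multiple of \<open>c\<close> bounds
  its scale, so existence and value of the maximum come together.\<close>

lemma rho_star_eqI:
  assumes "0 \<le> \<rho>" "\<rho> *\<^sub>R c \<in> hullQ A" "0 < d \<bullet> c" "\<And>i. d \<bullet> gen A i \<le> \<rho> * (d \<bullet> c)"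
  shows "rho_star A c = \<rho>"
  unfolding rho_star_def
proof (rule Greatest_equality)
  fix \<sigma> assume \<sigma>: "0 \<le> \<sigma> \<and> \<sigma> *\<^sub>R c \<in> hullQ A"
  have "d \<bullet> (\<sigma> *\<^sub>R c) \<le> \<rho> * (d \<bullet> c)"
    by (rule linear_le_on_hullQ) (use assms(4) \<sigma> in auto)
  then show "\<sigma> \<le> \<rho>" using assms(3) by simp
qed (use assms in auto)

lemma plpn_iter_0: "plpn_iter A c tie start \<rho>0 0 = Target \<rho>0 0 0"
  by (simp add: plpn_iter_def)

lemma plpn_iter_Suc:
  "plpn_iter A c tie start \<rho>0 (Suc k) = plpn_step A c tie start (plpn_iter A c tie start \<rho>0 k)"
  by (simp add: plpn_iter_def)

section \<open>Duality of the linear program\<close>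

lemma matrix_vector_row: "(A *v x) $ i = row i A \<bullet> x"
  by (simp add: matrix_vector_mul_component row_def vec_nth_inverse)

lemma transpose_vector_rows:
  fixes A :: "real^'n^'m"
  shows "transpose A *v u = (\<Sum>i\<in>UNIV. u $ i *\<^sub>R row i A)"
  by (simp add: matrix_mult_sum column_transpose scalar_mult_eq_scaleR)

lemma primal_feasible_iff: "primal_feasible A x \<longleftrightarrow> (\<forall>i. row i A \<bullet> x \<le> 1)"
  by (simp add: primal_feasible_def matrix_vector_row)

lemma weak_duality:
  fixes A :: "real^'n^'m"
  assumes "primal_feasible A x" "dual_feasible A c u"
  shows "c \<bullet> x \<le> (\<Sum>i\<in>UNIV. u $ i)"
proof -
  have "c = (\<Sum>i\<in>UNIV. u $ i *\<^sub>R row i A)"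
    using assms(2) unfolding dual_feasible_def transpose_vector_rows by simp
  then have "c \<bullet> x = (\<Sum>i\<in>UNIV. u $ i * (row i A \<bullet> x))"
    by (simp add: inner_sum_left)
  also have "\<dots> \<le> (\<Sum>i\<in>UNIV. u $ i * 1)"
    using assms by (intro sum_mono mult_left_mono) (auto simp: primal_feasible_iff dual_feasible_def)
  finally show ?thesis by simp
qed

text \<open>Being a corral depends on the target, which changes between iterations; affine
  independence does not, so independent families are counted.\<close>

lemma card_affine_indep_sets:
  fixes v :: "'i::finite \<Rightarrow> 'a::euclidean_space"
  shows "card {C. C \<noteq> {} \<and> affine_indep v C} \<le> (\<Sum>j = 1..min (DIM('a) + 1) CARD('i). CARD('i) choose j)"
proof -
  let ?J = "{1..min (DIM('a) + 1) CARD('i)}"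
  have "{C. C \<noteq> {} \<and> affine_indep v C} \<subseteq> (\<Union>j\<in>?J. {C. C \<subseteq> UNIV \<and> card C = j})"
  proof
    fix C assume C: "C \<in> {C. C \<noteq> {} \<and> affine_indep v C}"
    have "0 < card C" using C by (simp add: card_gt_0_iff)
    moreover have "card C \<le> CARD('i)" by (simp add: card_mono)
    ultimately show "C \<in> (\<Union>j\<in>?J. {C. C \<subseteq> UNIV \<and> card C = j})"
      using affine_indep_card_le[of v C] C by auto
  qed
  then have "card {C. C \<noteq> {} \<and> affine_indep v C} \<le> card (\<Union>j\<in>?J. {C. C \<subseteq> (UNIV :: 'i set) \<and> card C = j})"
    by (intro card_mono) auto
  also have "\<dots> \<le> (\<Sum>j\<in>?J. card {C. C \<subseteq> (UNIV :: 'i set) \<and> card C = j})"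
    by (rule card_UN_le) simp
  also have "\<dots> = (\<Sum>j\<in>?J. CARD('i) choose j)"
    by (intro sum.cong refl n_subsets) simp
  finally show ?thesis .
qed

section \<open>Recovering solutions from supporting hyperplanes\<close>

text \<open>A mean with positive weights can equal an upper bound of its terms only if every term
  attains it.\<close>

lemma complementary_slackness:
  fixes C :: "'i::finite set"
  assumes "\<forall>i\<in>C. 0 < w i" "sum w C = 1" "z = (\<Sum>i\<in>C. w i *\<^sub>R v i)"
    and le: "\<forall>i. d \<bullet> v i \<le> d \<bullet> z" and "i \<in> C"
  shows "d \<bullet> v i = d \<bullet> z"
proof -
  have "d \<bullet> z = (\<Sum>i\<in>C. w i * (d \<bullet> v i))"
    unfolding assms(3) by (simp add: inner_sum_right)
  moreover have "d \<bullet> z = (\<Sum>i\<in>C. w i * (d \<bullet> z))"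
    using assms(2) by (simp flip: sum_distrib_right)
  ultimately have "(\<Sum>i\<in>C. w i * (d \<bullet> z - d \<bullet> v i)) = 0"
    by (simp add: right_diff_distrib sum_subtractf)
  then have "\<forall>i\<in>C. w i * (d \<bullet> z - d \<bullet> v i) = 0"
    using assms(1) le by (subst (asm) sum_nonneg_eq_0_iff) (auto simp: less_imp_le)
  with assms(1,5) show ?thesis by force
qed

lemma inner_eq_on_comb:
  assumes "\<And>i. i \<in> C \<Longrightarrow> d \<bullet> v i = h" "sum w C = 1" "z = (\<Sum>i\<in>C. w i *\<^sub>R v i)"
  shows "d \<bullet> z = h"
  using assms by (simp add: inner_sum_right flip: sum_distrib_right)

text \<open>The hyperplane of \<open>d\<close> supports the hull at
  \<open>\<rho> *\<^sub>R c\<close>. Scaling \<open>d\<close> and the weights yields feasible points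
  of both programs with the common value \<open>1 / \<rho>\<close>, and weak duality makes both
  optimal.\<close>

lemma optimal_pair:
  fixes A :: "real^'n^'m"
  assumes "0 < \<rho>" and "0 < h" and dc: "\<rho> * (d \<bullet> c) = h" and d: "\<And>i. d \<bullet> gen A i \<le> h"
    and pos: "\<forall>i\<in>C. 0 < w i" and zero: "\<forall>i. i \<notin> C \<longrightarrow> w i = 0" and one: "sum w C = 1"
    and comb: "\<rho> *\<^sub>R c = (\<Sum>i\<in>C. w i *\<^sub>R gen A i)"
  defines "x \<equiv> d /\<^sub>R h" and "u \<equiv> (\<chi> i. w (Some i) / \<rho>)"
  shows "rho_star A c = \<rho>" "primal_optimal A c x" "dual_optimal A c u" "c \<bullet> x = 1 / \<rho>"
    "supporting_normal (hullQ A) (\<rho> *\<^sub>R c) d" "d \<bullet> (\<rho> *\<^sub>R c) = h"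
    "\<forall>i. 0 \<le> w (Some i)" "(\<Sum>i\<in>UNIV. w (Some i)) = 1"
    "\<rho> *\<^sub>R c = (\<Sum>i\<in>UNIV. w (Some i) *\<^sub>R row i A)"
proof -
  show dq: "d \<bullet> (\<rho> *\<^sub>R c) = h" using dc by simp
  have dcpos: "0 < d \<bullet> c" using dc \<open>0 < \<rho>\<close> \<open>0 < h\<close> by (metis zero_less_mult_pos)
  have "\<rho> *\<^sub>R c \<in> hullQ A"
    unfolding comb hullQ_def
    by (rule convex_sum) (use one pos in \<open>auto intro: hull_inc less_imp_le\<close>)
  then show "rho_star A c = \<rho>"
    using \<open>0 < \<rho>\<close> dcpos d dc by (intro rho_star_eqI[where d = d]) auto
  show "supporting_normal (hullQ A) (\<rho> *\<^sub>R c) d"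
    unfolding supporting_normal_def dq
    using dcpos \<open>\<rho> *\<^sub>R c \<in> hullQ A\<close> linear_le_on_hullQ[of d A h] d by auto
  \<comment> \<open>The zero generator lies strictly below the supporting hyperplane, so
    complementary slackness leaves only rows.\<close>
  have "w None = 0"
  proof (rule ccontr)
    assume "w None \<noteq> 0"
    then have "None \<in> C" using zero by blast
    then have "d \<bullet> gen A None = d \<bullet> (\<rho> *\<^sub>R c)"
      using complementary_slackness[OF pos one comb, of d None] d unfolding dq by blast
    then show False using dc \<open>0 < h\<close> by auto
  qed
  have split: "sum f C = sum (\<lambda>i. f (Some i)) UNIV" if "\<And>i. w i = 0 \<Longrightarrow> f i = 0" for f :: "_ \<Rightarrow> 'b::comm_monoid_add"
  proof -
    have "sum f C = sum f UNIV" using that zero by (intro sum.mono_neutral_left) auto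
    then show ?thesis using that[OF \<open>w None = 0\<close>] by (simp add: UNIV_option_conv sum.reindex)
  qed
  show sum1: "(\<Sum>i\<in>UNIV. w (Some i)) = 1" using split[of w] one by simp
  show comb': "\<rho> *\<^sub>R c = (\<Sum>i\<in>UNIV. w (Some i) *\<^sub>R row i A)"
    using split[of "\<lambda>i. w i *\<^sub>R gen A i"] comb by simp
  show nonneg: "\<forall>i. 0 \<le> w (Some i)" using pos zero by (metis less_imp_le order_refl)
  show cx: "c \<bullet> x = 1 / \<rho>"
    unfolding x_def using dc \<open>0 < \<rho>\<close> \<open>0 < h\<close> by (simp add: inner_commute field_simps)
  have "row i A \<bullet> x \<le> 1" for i
    using d[of "Some i"] \<open>0 < h\<close> by (simp add: x_def inner_commute field_simps)
  then have pf: "primal_feasible A x" by (simp add: primal_feasible_iff)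
  have "(\<Sum>i\<in>UNIV. u $ i *\<^sub>R row i A) = (\<rho> *\<^sub>R c) /\<^sub>R \<rho>"
    unfolding comb' u_def by (simp add: scaleR_sum_right divide_inverse mult.commute)
  then have df: "dual_feasible A c u"
    using \<open>0 < \<rho>\<close> nonneg unfolding dual_feasible_def transpose_vector_rows by (simp add: u_def)
  have su: "(\<Sum>i\<in>UNIV. u $ i) = 1 / \<rho>"
    using sum1 by (simp add: u_def flip: sum_divide_distrib)
  show "primal_optimal A c x"
    using pf weak_duality[OF _ df] cx su by (simp add: primal_optimal_def)
  show "dual_optimal A c u"
    using df weak_duality[OF pf] unfolding dual_optimal_def su cx[symmetric] by blast
qed

lemma recession:
  fixes A :: "real^'n^'m"
  assumes dc: "0 < d \<bullet> c" and d: "\<And>i. d \<bullet> gen A i \<le> 0"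
  defines "r \<equiv> d /\<^sub>R (c \<bullet> d)"
  shows "rho_star A c = 0" "\<forall>i. (A *v r) $ i \<le> 0" "c \<bullet> r = 1" "primal_unbounded A c"
proof -
  show "rho_star A c = 0"
    using dc d zero_in_hullQ by (intro rho_star_eqI[where d = d]) auto
  have cd: "0 < c \<bullet> d" using dc by (simp add: inner_commute)
  show cr: "c \<bullet> r = 1" unfolding r_def using cd by simp
  have row: "row i A \<bullet> r \<le> 0" for i
    using d[of "Some i"] cd by (simp add: r_def inner_commute mult_nonneg_nonpos)
  then show "\<forall>i. (A *v r) $ i \<le> 0" by (simp add: matrix_vector_row)
  show "primal_unbounded A c"
    unfolding primal_unbounded_def
  proof
    fix M :: real
    \<comment> \<open>As \<open>c \<bullet> r = 1\<close>, the multiple \<open>?t\<close> is the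
      objective value reached.\<close>
    let ?t = "\<bar>M\<bar> + 1"
    have "row i A \<bullet> (?t *\<^sub>R r) \<le> 1" for i
      using mult_nonneg_nonpos[of ?t "row i A \<bullet> r"] row[of i] by simp
    moreover have "M < c \<bullet> (?t *\<^sub>R r)" using cr by simp
    ultimately show "\<exists>x. primal_feasible A x \<and> M < c \<bullet> x"
      unfolding primal_feasible_iff by blast
  qed
qed

section \<open>A single outer iteration\<close>

text \<open>The final alternative of the theorem with the state as a parameter, so that it can be
  proved of the result of one step.\<close>

definition plpn_final ::
    "real^'n^'m \<Rightarrow> real^'n \<Rightarrow> (real^'n, real^'m) plpn_state \<Rightarrow> bool" where
  "plpn_final A c s \<longleftrightarrow>
     ((0 < rho_star A c \<and>
          (\<exists>x u. s = Return_Optimal x u \<and>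
             primal_optimal A c x \<and> dual_optimal A c u \<and>
             c \<bullet> x = 1 / rho_star A c \<and>
             (\<exists>d l. let q = rho_star A c *\<^sub>R c in
                supporting_normal (hullQ A) q d \<and> 0 < d \<bullet> q \<and> x = d /\<^sub>R (d \<bullet> q) \<and>
                (\<forall>i. 0 \<le> l i) \<and> (\<Sum>i\<in>UNIV. l i) = 1 \<and> q = (\<Sum>i\<in>UNIV. l i *\<^sub>R row i A) \<and>
                u = (\<chi> i. l i / rho_star A c)))) \<or>
         (rho_star A c = 0 \<and>
          (\<exists>r. s = Return_Recession r \<and>
             (\<forall>i. (A *v r) $ i \<le> 0) \<and> c \<bullet> r = 1 \<and> primal_unbounded A c)))"

text \<open>The first alternative serves the start, where \<open>d\<close> and \<open>h\<close> are
  dummies. From then on, the second says that the hyperplane of the last residual bounds the hull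
  and meets the ray exactly at the target.\<close>

definition plpn_inv :: "real^'n^'m \<Rightarrow> real^'n \<Rightarrow> real \<Rightarrow> real^'n \<Rightarrow> real \<Rightarrow> bool" where
  "plpn_inv A c \<rho> d h \<longleftrightarrow>
     0 < \<rho> \<and> (\<rho> *\<^sub>R c \<notin> hullQ A \<or>
              0 < h \<and> \<rho> * (d \<bullet> c) = h \<and> (\<forall>i. d \<bullet> gen A i \<le> h))"

text \<open>The trace of an iteration that chooses a further target: the residual starts at a point
  of the affine hull of \<open>C\<close>, and by complementary slackness all of \<open>C\<close>
  lies on the supporting hyperplane, which meets the ray at \<open>\<rho>'\<close>.\<close>

definition plpn_move ::
    "real^'n^'m \<Rightarrow> real^'n \<Rightarrow> real \<Rightarrow> real \<Rightarrow> real^'n \<Rightarrow> 'm option set \<Rightarrow> bool" where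
  "plpn_move A c \<rho> \<rho>' d C \<longleftrightarrow>
     C \<noteq> {} \<and> affine_indep (gen A) C \<and> \<rho>' < \<rho> \<and> d \<noteq> 0 \<and> 0 < d \<bullet> c \<and>
     (\<forall>i\<in>C. d \<bullet> gen A i = \<rho>' * (d \<bullet> c)) \<and>
     (\<exists>w. sum w C = 1 \<and> d = \<rho> *\<^sub>R c - (\<Sum>i\<in>C. w i *\<^sub>R gen A i))"

lemma plpn_final_not_Target: "\<not> plpn_final A c (Target \<rho> d h)"
  by (simp add: plpn_final_def)

text \<open>A target inside the hull is supported there by the previous residual, which gives the
  optimum. For a target outside, the new residual gives a recession direction if its support value
  is zero, and a smaller positive scale otherwise.\<close>

lemma plpn_step_Target:
  fixes A :: "real^'n^'m"
  assumes tie: "\<And>y s S. S \<noteq> {} \<Longrightarrow> tie y s S \<in> S" and inv: "plpn_inv A c \<rho> d h"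
  shows "(\<exists>\<rho>' d' h' C. plpn_step A c tie start (Target \<rho> d h) = Target \<rho>' d' h' \<and>
            plpn_inv A c \<rho>' d' h' \<and> plpn_move A c \<rho> \<rho>' d' C) \<or>
         plpn_final A c (plpn_step A c tie start (Target \<rho> d h))"
proof -
  define y where "y = \<rho> *\<^sub>R c"
  obtain z C w where W: "wolfe (gen A) tie start y = Some (z, C, w)"
    "z = closest_point (convex hull (range (gen A))) y" "corral (gen A) y C"
    "\<forall>i\<in>C. 0 < w i" "\<forall>i. i \<notin> C \<longrightarrow> w i = 0" "sum w C = 1" "z = (\<Sum>i\<in>C. w i *\<^sub>R gen A i)"
    "\<forall>i. (y - z) \<bullet> gen A i \<le> (y - z) \<bullet> z"
    by (rule wolfe_correct[of tie "gen A" start y, OF tie])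
  have "0 < \<rho>" using inv by (simp add: plpn_inv_def)
  show ?thesis
  proof (cases "z = y")
    case True
    have "z \<in> hullQ A"
      unfolding W(7) hullQ_def
      by (rule convex_sum) (use W(4,6) in \<open>auto intro: hull_inc less_imp_le\<close>)
    then have h: "0 < h" "\<rho> * (d \<bullet> c) = h" "\<And>i. d \<bullet> gen A i \<le> h"
      using inv True by (auto simp: plpn_inv_def y_def)
    have "\<rho> *\<^sub>R c = (\<Sum>i\<in>C. w i *\<^sub>R gen A i)" using True W(7) by (simp add: y_def)
    note opt = optimal_pair[OF \<open>0 < \<rho>\<close> h W(4-6) this]
    have step: "plpn_step A c tie start (Target \<rho> d h) =
        Return_Optimal (d /\<^sub>R h) (\<chi> i. w (Some i) / \<rho>)"
      using W(1) True \<open>0 < \<rho>\<close> by (simp add: Let_def flip: y_def)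
    have "\<exists>d' l. let q = rho_star A c *\<^sub>R c in
        supporting_normal (hullQ A) q d' \<and> 0 < d' \<bullet> q \<and> d /\<^sub>R h = d' /\<^sub>R (d' \<bullet> q) \<and>
        (\<forall>i. 0 \<le> l i) \<and> (\<Sum>i\<in>UNIV. l i) = 1 \<and> q = (\<Sum>i\<in>UNIV. l i *\<^sub>R row i A) \<and>
        (\<chi> i. w (Some i) / \<rho>) = (\<chi> i. l i / rho_star A c)"
      unfolding opt(1) Let_def
      by (rule exI[of _ d], rule exI[of _ "\<lambda>i. w (Some i)"]) (use opt(5-9) \<open>0 < h\<close> in auto)
    then have "plpn_final A c (plpn_step A c tie start (Target \<rho> d h))"
      unfolding plpn_final_def step using opt(1-4) \<open>0 < \<rho>\<close> by blast
    then show ?thesis ..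
  next
    case False
    define d' where "d' = y - z"
    define h' where "h' = d' \<bullet> z"
    have d'le: "d' \<bullet> gen A i \<le> h'" for i using W(8) by (simp add: d'_def h'_def)
    \<comment> \<open>The zero generator keeps the support value nonnegative.\<close>
    have "0 \<le> h'" using d'le[of None] by simp
    have "d' \<noteq> 0" using False by (simp add: d'_def)
    \<comment> \<open>Since \<open>y = z + d'\<close>, the target exceeds the support value by the
      squared residual; this gives both \<open>0 < d' \<bullet> c\<close> and the decrease of the
      scale.\<close>
    have "\<rho> * (d' \<bullet> c) = h' + d' \<bullet> d'"
      by (simp add: h'_def d'_def y_def flip: inner_add_right)
    moreover have "0 < d' \<bullet> d'" using \<open>d' \<noteq> 0\<close> by simp
    ultimately have gap: "h' < \<rho> * (d' \<bullet> c)" by linarith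
    with \<open>0 \<le> h'\<close> have "0 < \<rho> * (d' \<bullet> c)" by linarith
    with \<open>0 < \<rho>\<close> have dc: "0 < d' \<bullet> c" by (metis zero_less_mult_pos)
    have step: "plpn_step A c tie start (Target \<rho> d h) =
        (if h' = 0 then Return_Recession (d' /\<^sub>R (c \<bullet> d')) else Target (h' / (d' \<bullet> c)) d' h')"
      using W(1) False by (simp add: Let_def h'_def d'_def flip: y_def)
    show ?thesis
    proof (cases "h' = 0")
      case True
      then have "d' \<bullet> gen A i \<le> 0" for i using d'le by simp
      from recession[OF dc this] have "plpn_final A c (plpn_step A c tie start (Target \<rho> d h))"
        using step True by (simp add: plpn_final_def)
      then show ?thesis ..
    next
      case False
      define \<rho>' where "\<rho>' = h' / (d' \<bullet> c)"
      have \<rho>': "\<rho>' * (d' \<bullet> c) = h'" using dc by (simp add: \<rho>'_def)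
      have "0 < h'" using False \<open>0 \<le> h'\<close> by simp
      then have "plpn_inv A c \<rho>' d' h'"
        using \<rho>' dc d'le by (simp add: plpn_inv_def \<rho>'_def)
      moreover have "plpn_move A c \<rho> \<rho>' d' C"
      proof -
        have "\<rho>' < \<rho>" using gap dc by (simp add: \<rho>'_def pos_divide_less_eq)
        moreover have "\<forall>i\<in>C. d' \<bullet> gen A i = h'"
          using complementary_slackness[OF W(4,6,7), of d'] d'le by (simp add: h'_def)
        moreover have "C \<noteq> {}" "affine_indep (gen A) C"
          using W(3) by (auto simp: corral_def affine_indep_def)
        ultimately show ?thesis
          unfolding plpn_move_def \<rho>' using dc \<open>d' \<noteq> 0\<close> W(6,7) by (auto simp: d'_def y_def)
      qed
      ultimately show ?thesis using step False by (auto simp: \<rho>'_def)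
    qed
  qed
qed

text \<open>
  If two moves had the same corral, both nearest points would lie in the supporting hyperplane of
  the earlier residual. The choice of the next target then makes the two residuals meet at a
  nonacute angle, although along one affine hull the residual changes by a multiple of
  \<open>c\<close> modulo directions orthogonal to the later one, so the angle is acute.
\<close>

lemma plpn_moves_distinct:
  assumes m1: "plpn_move A c \<rho>1 \<sigma>1 d1 C" and m2: "plpn_move A c \<rho>2 \<sigma>2 d2 C" and le: "\<rho>2 \<le> \<sigma>1"
  shows False
proof -
  obtain w1 z1 where w1: "sum w1 C = 1" "z1 = (\<Sum>i\<in>C. w1 i *\<^sub>R gen A i)" "d1 = \<rho>1 *\<^sub>R c - z1"
    using m1 unfolding plpn_move_def by blast
  obtain w2 z2 where w2: "sum w2 C = 1" "z2 = (\<Sum>i\<in>C. w2 i *\<^sub>R gen A i)" "d2 = \<rho>2 *\<^sub>R c - z2"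
    using m2 unfolding plpn_move_def by blast
  have on1: "d1 \<bullet> gen A i = \<sigma>1 * (d1 \<bullet> c)" and on2: "d2 \<bullet> gen A i = \<sigma>2 * (d2 \<bullet> c)" if "i \<in> C" for i
    using m1 m2 that by (auto simp: plpn_move_def)
  have z: "d1 \<bullet> z2 = \<sigma>1 * (d1 \<bullet> c)" "d2 \<bullet> z1 = \<sigma>2 * (d2 \<bullet> c)" "d2 \<bullet> z2 = \<sigma>2 * (d2 \<bullet> c)"
    using inner_eq_on_comb[OF on1 w2(1,2)] inner_eq_on_comb[OF on2 w1(1,2)]
      inner_eq_on_comb[OF on2 w2(1,2)] by blast+
  have pos: "0 < d1 \<bullet> c" "0 < d2 \<bullet> c" "0 < d2 \<bullet> d2" and less: "\<rho>2 < \<rho>1"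
    using m1 m2 le by (auto simp: plpn_move_def)
  have "d1 \<bullet> d2 = (\<rho>2 - \<sigma>1) * (d1 \<bullet> c)"
    using z(1) arg_cong[OF w2(3), of "(\<bullet>) d1"] by (simp add: inner_diff_right left_diff_distrib)
  then have "d1 \<bullet> d2 \<le> 0" using pos(1) le by (simp add: mult_nonpos_nonneg)
  moreover have "d2 \<bullet> d1 = d2 \<bullet> d2 + (\<rho>1 - \<rho>2) * (d2 \<bullet> c)"
    using z(2,3) arg_cong[OF w1(3), of "(\<bullet>) d2"] arg_cong[OF w2(3), of "(\<bullet>) d2"]
    by (simp add: inner_diff_right left_diff_distrib)
  moreover have "0 < (\<rho>1 - \<rho>2) * (d2 \<bullet> c)" using less pos(2) by simp
  ultimately show False using pos(3) by (simp add: inner_commute)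
qed

section \<open>Bounding the number of outer iterations\<close>

text \<open>The functional \<open>c\<close> itself separates the first target from the hull: its
  value there is \<open>\<rho>0\<close>, as \<open>c\<close> is a unit vector.\<close>

lemma plpn_inv_start:
  fixes A :: "real^'n^'m"
  assumes "norm c = 1" "Max (range (\<lambda>i. c \<bullet> gen A i)) < \<rho>0"
  shows "plpn_inv A c \<rho>0 d h"
proof -
  let ?M = "Max (range (\<lambda>i. c \<bullet> gen A i))"
  have le: "c \<bullet> gen A i \<le> ?M" for i by (rule Max_ge) auto
  have "0 < \<rho>0" using order_le_less_trans[OF le[of None] assms(2)] by simp
  moreover have "\<rho>0 *\<^sub>R c \<notin> hullQ A"
  proof
    assume "\<rho>0 *\<^sub>R c \<in> hullQ A"
    then have "c \<bullet> (\<rho>0 *\<^sub>R c) \<le> ?M" using le by (rule linear_le_on_hullQ[rotated])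
    moreover have "c \<bullet> c = 1" using assms(1) by (simp flip: power2_norm_eq_inner)
    ultimately show False using assms(2) by simp
  qed
  ultimately show ?thesis by (simp add: plpn_inv_def)
qed

lemma plpn_inv_iter:
  fixes A :: "real^'n^'m"
  assumes tie: "\<And>y s S. S \<noteq> {} \<Longrightarrow> tie y s S \<in> S"
    and start: "norm c = 1" "Max (range (\<lambda>i. c \<bullet> gen A i)) < \<rho>0"
    and "plpn_iter A c tie start \<rho>0 k = Target \<rho> d h"
  shows "plpn_inv A c \<rho> d h"
  using assms(4)
proof (induction k arbitrary: \<rho> d h)
  case 0
  then show ?case using plpn_inv_start[OF start] by (simp add: plpn_iter_0)
next
  case (Suc k)
  show ?case
  proof (cases "plpn_iter A c tie start \<rho>0 k")
    case (Target \<sigma> e g)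
    then have "plpn_step A c tie start (Target \<sigma> e g) = Target \<rho> d h"
      using Suc.prems by (simp only: plpn_iter_Suc)
    with plpn_step_Target[of tie A c \<sigma> e g start, OF tie Suc.IH[OF Target]] show ?thesis
      by (simp add: plpn_final_not_Target del: plpn_step.simps)
  qed (use Suc.prems in \<open>auto simp: plpn_iter_Suc\<close>)
qed

text \<open>The targets with indices \<open>0\<close> to \<open>N\<close> are joined by
  \<open>N\<close> moves with distinct corrals; the summand 1 of \<open>Kbound\<close> makes the
  inequality strict.\<close>

lemma plpn_length:
  fixes A :: "real^'n^'m"
  assumes tie: "\<And>y s S. S \<noteq> {} \<Longrightarrow> tie y s S \<in> S"
    and start: "norm c = 1" "Max (range (\<lambda>i. c \<bullet> gen A i)) < \<rho>0"
    and targets: "\<And>k. k \<le> N \<Longrightarrow> \<exists>\<rho> d h. plpn_iter A c tie start \<rho>0 k = Target \<rho> d h"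
  shows "N < Kbound (CARD('m) + 1) CARD('n)"
proof -
  \<comment> \<open>The default 0 is never read: only indices up to \<open>N\<close> occur, and all
    of these are targets.\<close>
  define R where "R k = (case plpn_iter A c tie start \<rho>0 k of Target \<rho> d h \<Rightarrow> \<rho> | _ \<Rightarrow> 0)" for k
  have "\<exists>d C. plpn_move A c (R k) (R (Suc k)) d C" if k: "k < N" for k
  proof -
    obtain \<rho> d h where T: "plpn_iter A c tie start \<rho>0 k = Target \<rho> d h"
      using targets[of k] k by auto
    obtain \<rho>' d' h' where T': "plpn_iter A c tie start \<rho>0 (Suc k) = Target \<rho>' d' h'"
      using targets[of "Suc k"] k by auto
    have inv: "plpn_inv A c \<rho> d h"
      using tie start T by (rule plpn_inv_iter)
    have "plpn_step A c tie start (Target \<rho> d h) = Target \<rho>' d' h'"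
      using T T' by (simp only: plpn_iter_Suc)
    with plpn_step_Target[of tie A c \<rho> d h start, OF tie inv]
    have "\<exists>C. plpn_move A c \<rho> \<rho>' d' C"
      by (simp add: plpn_final_not_Target del: plpn_step.simps)
    then show ?thesis using T T' by (auto simp: R_def)
  qed
  then obtain D C where move: "\<And>k. k < N \<Longrightarrow> plpn_move A c (R k) (R (Suc k)) (D k) (C k)"
    by metis
  \<comment> \<open>A later target lies no farther out than the one chosen by the earlier move, as
    the comparison of two moves requires.\<close>
  have R: "R l \<le> R (Suc k)" if "k < l" "l \<le> N" for k l
    using that
  proof (induction l)
    case (Suc l)
    have "R (Suc l) < R l" using move[of l] Suc.prems by (simp add: plpn_move_def)
    then show ?case using Suc by (cases "k = l") auto
  qed simp
  have ne: "C k \<noteq> C l" if "k < l" "l < N" for k l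
    using plpn_moves_distinct[of A c "R k" "R (Suc k)" "D k" "C k" "R l" "R (Suc l)" "D l"]
      move[of k] move[of l] R[of k l] that by auto
  have inj: "inj_on C {..<N}"
    by (rule inj_onI) (metis ne lessThan_iff linorder_neqE_nat)
  have "N = card (C ` {..<N})" using card_image[OF inj] by simp
  also have "\<dots> \<le> card {C. C \<noteq> {} \<and> affine_indep (gen A) C}"
    using move by (intro card_mono) (auto simp: plpn_move_def)
  also have "\<dots> \<le> (\<Sum>j = 1..min (CARD('n) + 1) (CARD('m) + 1). (CARD('m) + 1) choose j)"
    using card_affine_indep_sets[of "gen A"] by (simp add: card_UNIV_option)
  finally show ?thesis by (simp add: Kbound_def)
qed

theorem theorem2:
  fixes A :: "real^'n^'m" and c :: "real^'n" and \<rho>0 :: real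
    and tie :: "real^'n \<Rightarrow> 'm option wolfe_state \<Rightarrow> 'm option set \<Rightarrow> 'm option"
    and start :: "real^'n \<Rightarrow> 'm option"
  assumes "norm c = 1"
    and "Max (range (\<lambda>i. c \<bullet> gen A i)) < \<rho>0"
    and "\<And>y s S. S \<noteq> {} \<Longrightarrow> tie y s S \<in> S"
  shows
    "(\<forall>k \<rho> d h. plpn_iter A c tie start \<rho>0 k = Target \<rho> d h \<longrightarrow>
        (\<exists>z C w. wolfe (gen A) tie start (\<rho> *\<^sub>R c) = Some (z, C, w) \<and>
           z = closest_point (hullQ A) (\<rho> *\<^sub>R c) \<and>
           corral (gen A) (\<rho> *\<^sub>R c) C \<and>
           (\<forall>i\<in>C. 0 < w i) \<and> (\<forall>i. i \<notin> C \<longrightarrow> w i = 0) \<and> sum w C = 1 \<and>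
           z = (\<Sum>i\<in>C. w i *\<^sub>R gen A i))) \<and>
     (\<exists>N \<le> Kbound (CARD('m) + 1) CARD('n).
        (\<forall>k<N. \<exists>\<rho> d h. plpn_iter A c tie start \<rho>0 k = Target \<rho> d h) \<and>
        ((0 < rho_star A c \<and>
          (\<exists>x u. plpn_iter A c tie start \<rho>0 N = Return_Optimal x u \<and>
             primal_optimal A c x \<and> dual_optimal A c u \<and>
             c \<bullet> x = 1 / rho_star A c \<and>
             (\<exists>d l. let q = rho_star A c *\<^sub>R c in
                supporting_normal (hullQ A) q d \<and> 0 < d \<bullet> q \<and> x = d /\<^sub>R (d \<bullet> q) \<and>
                (\<forall>i. 0 \<le> l i) \<and> (\<Sum>i\<in>UNIV. l i) = 1 \<and> q = (\<Sum>i\<in>UNIV. l i *\<^sub>R row i A) \<and>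
                u = (\<chi> i. l i / rho_star A c)))) \<or>
         (rho_star A c = 0 \<and>
          (\<exists>r. plpn_iter A c tie start \<rho>0 N = Return_Recession r \<and>
             (\<forall>i. (A *v r) $ i \<le> 0) \<and> c \<bullet> r = 1 \<and> primal_unbounded A c))))"
proof -
  let ?it = "plpn_iter A c tie start \<rho>0" and ?K = "Kbound (CARD('m) + 1) CARD('n)"
  let ?isT = "\<lambda>k. \<exists>\<rho> d h. ?it k = Target \<rho> d h"
  have wolfe: "\<exists>z C w. wolfe (gen A) tie start y = Some (z, C, w) \<and>
           z = closest_point (hullQ A) y \<and> corral (gen A) y C \<and>
           (\<forall>i\<in>C. 0 < w i) \<and> (\<forall>i. i \<notin> C \<longrightarrow> w i = 0) \<and> sum w C = 1 \<and>
           z = (\<Sum>i\<in>C. w i *\<^sub>R gen A i)" for y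
    by (rule wolfe_correct[of tie "gen A" start y, OF assms(3)]) (auto simp: hullQ_def)
  \<comment> \<open>If all states up to index \<open>?K\<close> were targets, the length bound would
    give \<open>?K < ?K\<close>.\<close>
  have "\<exists>k\<le>?K. \<not> ?isT k"
  proof (rule ccontr)
    assume "\<not> (\<exists>k\<le>?K. \<not> ?isT k)"
    then have targets: "?isT k" if "k \<le> ?K" for k using that by blast
    have "?K < ?K" using assms(3,1,2) targets by (rule plpn_length)
    then show False by simp
  qed
  then obtain k where k: "k \<le> ?K" "\<not> ?isT k" by blast
  \<comment> \<open>The first state that is no target has a target as predecessor, so the step
    between them must produce a final state.\<close>
  define N where "N = (LEAST k. \<not> ?isT k)"
  have N: "\<not> ?isT N" "N \<le> ?K" "\<And>k. k < N \<Longrightarrow> ?isT k"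
    unfolding N_def
    subgoal using k(2) by (rule LeastI)
    subgoal using Least_le[of "\<lambda>k. \<not> ?isT k", OF k(2)] k(1) by linarith
    subgoal using not_less_Least by blast
    done
  have "N \<noteq> 0"
  proof
    assume "N = 0"
    then have "?it N = Target \<rho>0 0 0" by (simp add: plpn_iter_0)
    with N(1) show False by blast
  qed
  then obtain M where M: "N = Suc M" using not0_implies_Suc by blast
  obtain \<rho> d h where T: "?it M = Target \<rho> d h" using N(3)[of M] M by auto
  have inv: "plpn_inv A c \<rho> d h"
    using assms(3,1,2) T by (rule plpn_inv_iter)
  have "?it N = plpn_step A c tie start (Target \<rho> d h)"
    using T M by (simp only: plpn_iter_Suc)
  with plpn_step_Target[of tie A c \<rho> d h start, OF assms(3) inv] N(1)
  have "plpn_final A c (?it N)" by (simp del: plpn_step.simps)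
  then have "N \<le> ?K \<and> (\<forall>k<N. ?isT k) \<and> plpn_final A c (?it N)"
    using N(2,3) by simp
  then show ?thesis
    unfolding plpn_final_def by (intro conjI allI impI wolfe) (rule exI)
qed

end
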